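(* Let $p,q$ be probability densities on $\mathbb{R}$ such that $p$ is supported on a finite union of intervals (i.e. $\{x: p(x)>0\}$ is a finite union of intervals) and $\{x:q(x)>0\}=\mathbb{R}$. Then for any $\epsilon>0$ there exists a planar flow $f$ on $\mathbb{R}$ such that $\|f\#q-p\|_1\le\epsilon$, where $\|\cdot\|_1$ is the $L^1(\mathbb{R})$ norm.
   Context: A normalizing flow on $\mathbb{R}^d$ is an invertible function $f:\mathbb{R}^d\to\mathbb{R}^d$ that is differentiable almost everywhere and satisfies $\det J_f(z)\neq 0$ for almost every $z$, where $J_f$ is the Jacobian matrix. If $z$ is a random variable with density $q$, then $f\#q$ denotes the density of $f(z)$; it satisfies $(f\#q)(f(z))=q(z)/|\det J_f(z)|$. A planar flow on $\mathbb{R}$ is a normalizing flow of the form $f(z)=z+u\,h(wz+b)$ with $u,w,b\in\mathbb{R}$ and a function $h:\mathbb{R}\to\mathbb{R}$ (the non-linearity). Here the non-linearity $h$ may be chosen as part of the flow. *)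

theory Defs
  imports "HOL-Probability.Probability"
begin

definition prob_density :: "(real \<Rightarrow> real) \<Rightarrow> bool" where
  "prob_density p \<longleftrightarrow> (\<forall>x. 0 \<le> p x) \<and> has_bochner_integral lebesgue p 1"

definition finite_union_of_intervals :: "real set \<Rightarrow> bool" where
  "finite_union_of_intervals S \<longleftrightarrow>
     (\<exists>\<I>. finite \<I> \<and> (\<forall>I\<in>\<I>. is_interval I) \<and> S = \<Union>\<I>)"

(* In dimension one the Jacobian determinant of f at z is deriv f z. *)
definition normalizing_flow :: "(real \<Rightarrow> real) \<Rightarrow> bool" where
  "normalizing_flow f \<longleftrightarrow>
     bij f \<and>
     (AE z in lebesgue. f differentiable (at z)) \<and>
     (AE z in lebesgue. deriv f z \<noteq> 0)"

definition planar_flow :: "(real \<Rightarrow> real) \<Rightarrow> bool" where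
  "planar_flow f \<longleftrightarrow>
     normalizing_flow f \<and>
     (\<exists>(u::real) (w::real) (b::real) (h::real \<Rightarrow> real). \<forall>z. f z = z + u * h (w * z + b))"

(* r is a version of f#q: if z has density q, then f z has density r.  It is a relation
   because a density is determined only up to null sets; the L1 distance below does not depend
   on the version.  The law of f z is used rather than the formula r (f z) = q z / |deriv f z|,
   which leaves r undetermined on the image of the null set where f is not differentiable;
   that image can have positive measure. *)
definition pushforward_density ::
    "(real \<Rightarrow> real) \<Rightarrow> (real \<Rightarrow> real) \<Rightarrow> (real \<Rightarrow> real) \<Rightarrow> bool" where
  "pushforward_density f q r \<longleftrightarrow>
     (\<forall>x. 0 \<le> r x) \<and>
     distributed (density lebesgue (\<lambda>z. ennreal (q z))) lebesgue f (\<lambda>x. ennreal (r x))"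

definition L1_norm :: "(real \<Rightarrow> real) \<Rightarrow> ennreal" where
  "L1_norm g = (\<integral>\<^sup>+ x. ennreal \<bar>g x\<bar> \<partial>lebesgue)"

end

theory Submission
  imports Defs
begin

text \<open>
  Since the non-linearity is free, every bijection is of planar form with $u = w = 1$,
  $b = 0$ and $h(z) = f(z) - z$. A monotone transport between $q$ and (a perturbation
  of) $p$ would need Lebesgue's differentiation theorem to be differentiable almost everywhere.
  This is avoided by first approximating $q$ and $p$ in $L^1$ by continuous positive densities $a$
  and $b$: with $A$ and $B$ their distribution functions, $f = B^{-1} \circ A$ is a
  $C^1$-diffeomorphism that pushes $a$ to $b$. Pushing forward is an $L^1$-isometry, so
  $\|f\#q - p\|_1 \le \|q - a\|_1 + \|b - p\|_1$.
\<close>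

section \<open>Approximation of a density in L^1 by continuous positive densities\<close>

text \<open>A measurable function is an almost everywhere limit of continuous functions, but this
  convergence has no integrable majorant. So \<open>p\<close> is first cut off at a multiple of the
  Gaussian, and the continuous functions are then clipped at the same height. Dominated convergence
  handles each stage; adding a small Gaussian and dividing by the total mass finishes.\<close>

lemma continuous_density_approx:
  fixes p :: "real \<Rightarrow> real"
  assumes p: "prob_density p" and e: "e > 0"
  obtains g where "continuous_on UNIV g" "\<And>x. 0 < g x"
    "has_bochner_integral lebesgue g 1" "(\<integral>x. \<bar>g x - p x\<bar> \<partial>lebesgue) < e"
proof -
  \<comment> \<open>Two limits and the added Gaussian cost \<open>d\<close> each, so
    \<open>g\<close> is within \<open>3 * d\<close> of \<open>p\<close>. Normalizing costs
    \<open>\<bar>1 - c\<bar>\<close>, which is bounded by that same distance, hence less than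
    \<open>3 * d\<close> again.\<close>
  define d where "d = e / 6"
  have d: "d > 0" using e by (simp add: d_def)
  define \<phi> where "\<phi> = std_normal_density"
  have \<phi>c: "continuous_on UNIV \<phi>"
    unfolding \<phi>_def normal_density_def by (intro continuous_intros) auto
  have \<phi>pos: "\<phi> x > 0" for x by (simp add: \<phi>_def normal_density_pos)
  have \<phi>m: "\<phi> \<in> borel_measurable borel" by (simp add: \<phi>_def)
  have \<phi>i: "integrable lebesgue \<phi>"
    using integrable_normal_density[of 1 0] \<phi>m by (simp add: \<phi>_def integrable_completion)
  have \<phi>1: "integral\<^sup>L lebesgue \<phi> = 1"
    using integral_normal_density[of 1 0] \<phi>m by (simp add: \<phi>_def integral_completion)
  have pi: "integrable lebesgue p" and p1: "integral\<^sup>L lebesgue p = 1" and p0: "0 \<le> p x" for x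
    using p by (auto simp: prob_density_def has_bochner_integral_iff)
  have pm: "p \<in> borel_measurable lebesgue" using pi by simp
  have cm: "f \<in> borel_measurable lebesgue" if "continuous_on UNIV f" for f :: "real \<Rightarrow> real"
    using borel_measurable_continuous_onI[OF that] by (auto intro: measurable_completion)
  have "p measurable_on UNIV"
    using lebesgue_measurable_imp_measurable_on[of p UNIV] pm by simp
  then obtain N h where N: "negligible N" and hc: "\<And>n::nat. continuous_on UNIV (h n)"
    and hl: "\<And>x. x \<notin> N \<Longrightarrow> (\<lambda>n. h n x) \<longlonglongrightarrow> p x"
    unfolding measurable_on_def by auto
  have N0: "AE x in lebesgue. x \<notin> N"
    using N by (auto simp: negligible_iff_null_sets intro: AE_not_in)
  \<comment> \<open>The Gaussian supplies the integrable majorants for dominated convergence and, later, strict positivity.\<close>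
  define t where "t k x = min (p x) (real k * \<phi> x)" for k x
  have tm: "t k \<in> borel_measurable lebesgue" for k
    unfolding t_def using pm cm[OF \<phi>c] by measurable
  have "(\<lambda>k. \<integral>x. \<bar>t k x - p x\<bar> \<partial>lebesgue) \<longlonglongrightarrow> (\<integral>x. 0 \<partial>(lebesgue :: real measure))"
  proof (rule integral_dominated_convergence[where w = p])
    show "AE x in lebesgue. (\<lambda>k. \<bar>t k x - p x\<bar>) \<longlonglongrightarrow> 0"
    proof (rule AE_I2)
      fix x
      obtain K :: nat where K: "p x < real K * \<phi> x" using \<phi>pos[of x] ex_less_of_nat_mult by blast
      have "\<bar>t k x - p x\<bar> = 0" if "k \<ge> K" for k
      proof -
        have "real K * \<phi> x \<le> real k * \<phi> x" using that \<phi>pos[of x] by simp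
        then show ?thesis using K by (simp add: t_def)
      qed
      then show "(\<lambda>k. \<bar>t k x - p x\<bar>) \<longlonglongrightarrow> 0"
        by (intro tendsto_eventually) (auto simp: eventually_sequentially)
    qed
    show "AE x in lebesgue. norm \<bar>t k x - p x\<bar> \<le> p x" for k
    proof (rule AE_I2)
      fix x
      have "0 \<le> real k * \<phi> x" using \<phi>pos[of x] by simp
      then show "norm \<bar>t k x - p x\<bar> \<le> p x" using p0[of x] by (auto simp: t_def)
    qed
  qed (use tm pm pi in \<open>auto intro!: borel_measurable_abs borel_measurable_diff\<close>)
  then have "\<forall>\<^sub>F k in sequentially. (\<integral>x. \<bar>t k x - p x\<bar> \<partial>lebesgue) < d"
    using d by (simp add: order_tendsto_iff)
  then obtain k where k: "(\<integral>x. \<bar>t k x - p x\<bar> \<partial>lebesgue) < d"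
    by (auto simp: eventually_sequentially)
  \<comment> \<open>The clipping is continuous and leaves \<open>t k\<close> fixed, so
    \<open>s n\<close> tends to \<open>t k\<close> wherever \<open>h n\<close> tends to
    \<open>p\<close>. Both functions lie between 0 and \<open>real k * \<phi>\<close>, which
    therefore dominates their distance.\<close>
  define s where "s n x = max 0 (min (h n x) (real k * \<phi> x))" for n x
  have sc: "continuous_on UNIV (s n)" for n
    unfolding s_def by (intro continuous_intros hc \<phi>c)
  have sb: "0 \<le> s n x" "s n x \<le> real k * \<phi> x" for n x
    using \<phi>pos[of x] by (auto simp: s_def)
  have tb: "0 \<le> t k x" "t k x \<le> real k * \<phi> x" for x
    using \<phi>pos[of x] p0[of x] by (auto simp: t_def)
  have k\<phi>i: "integrable lebesgue (\<lambda>x. real k * \<phi> x)" using \<phi>i by simp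
  have "(\<lambda>n. \<integral>x. \<bar>s n x - t k x\<bar> \<partial>lebesgue) \<longlonglongrightarrow> (\<integral>x. 0 \<partial>(lebesgue :: real measure))"
  proof (rule integral_dominated_convergence[where w = "\<lambda>x. real k * \<phi> x"])
    show "AE x in lebesgue. (\<lambda>n. \<bar>s n x - t k x\<bar>) \<longlonglongrightarrow> 0"
      using N0
    proof eventually_elim
      case (elim x)
      have "(\<lambda>n. s n x) \<longlonglongrightarrow> max 0 (min (p x) (real k * \<phi> x))"
        unfolding s_def by (intro tendsto_intros hl elim)
      also have "max 0 (min (p x) (real k * \<phi> x)) = t k x" using tb[of x] by (simp add: t_def)
      finally show ?case by (simp add: tendsto_rabs_zero_iff LIM_zero_iff)
    qed
    show "AE x in lebesgue. norm \<bar>s n x - t k x\<bar> \<le> real k * \<phi> x" for n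
    proof (rule AE_I2)
      fix x show "norm \<bar>s n x - t k x\<bar> \<le> real k * \<phi> x"
        using sb[of n x] tb[of x] by auto
    qed
  qed (use tm cm[OF sc] k\<phi>i in \<open>auto intro!: borel_measurable_abs borel_measurable_diff\<close>)
  then have "\<forall>\<^sub>F n in sequentially. (\<integral>x. \<bar>s n x - t k x\<bar> \<partial>lebesgue) < d"
    using d by (simp add: order_tendsto_iff)
  then obtain n where n: "(\<integral>x. \<bar>s n x - t k x\<bar> \<partial>lebesgue) < d"
    by (auto simp: eventually_sequentially)
  define g where "g x = s n x + d * \<phi> x" for x
  have gc: "continuous_on UNIV g"
    unfolding g_def by (intro continuous_intros sc \<phi>c)
  have gpos: "g x > 0" for x
    using sb(1)[of n x] \<phi>pos[of x] d by (simp add: g_def add_nonneg_pos)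
  have si: "integrable lebesgue (s n)"
    by (rule Bochner_Integration.integrable_bound[OF k\<phi>i cm[OF sc]]) (use sb in \<open>auto intro!: AE_I2 order_trans[OF _ abs_ge_self]\<close>)
  have ti: "integrable lebesgue (t k)"
    by (rule Bochner_Integration.integrable_bound[OF k\<phi>i tm]) (use tb in \<open>auto intro!: AE_I2 order_trans[OF _ abs_ge_self]\<close>)
  have gi: "integrable lebesgue g" unfolding g_def using si \<phi>i by auto
  have "(\<integral>x. \<bar>g x - p x\<bar> \<partial>lebesgue) \<le> (\<integral>x. \<bar>s n x - t k x\<bar> + \<bar>t k x - p x\<bar> + d * \<phi> x \<partial>lebesgue)"
  proof (rule integral_mono)
    fix x show "\<bar>g x - p x\<bar> \<le> \<bar>s n x - t k x\<bar> + \<bar>t k x - p x\<bar> + d * \<phi> x"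
      using mult_pos_pos[OF d \<phi>pos[of x]] unfolding g_def by linarith
  qed (use gi pi si ti \<phi>i in auto)
  also have "\<dots> = (\<integral>x. \<bar>s n x - t k x\<bar> \<partial>lebesgue) + (\<integral>x. \<bar>t k x - p x\<bar> \<partial>lebesgue) + d"
    using gi pi si ti \<phi>i \<phi>1 by simp
  also have "\<dots> < 3 * d" using k n by simp
  finally have gp: "(\<integral>x. \<bar>g x - p x\<bar> \<partial>lebesgue) < 3 * d" .
  define c where "c = integral\<^sup>L lebesgue g"
  have "integral\<^sup>L lebesgue (\<lambda>x. d * \<phi> x) \<le> c"
    unfolding c_def by (rule integral_mono) (use \<phi>i gi sb in \<open>auto simp: g_def\<close>)
  then have c: "c > 0" using d \<phi>1 by simp
  have "c - 1 = (\<integral>x. g x - p x \<partial>lebesgue)"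
    using gi pi p1 by (simp add: c_def)
  then have c1: "\<bar>c - 1\<bar> < 3 * d"
    using gp integral_abs_bound[of lebesgue "\<lambda>x. g x - p x"] by linarith
  \<comment> \<open>Since \<open>g\<close> has integral \<open>c\<close>, the first summand on the
    right integrates to exactly \<open>\<bar>1 - c\<bar>\<close>.\<close>
  have "(\<integral>x. \<bar>g x / c - p x\<bar> \<partial>lebesgue) \<le> (\<integral>x. \<bar>1 - c\<bar> / c * g x + \<bar>g x - p x\<bar> \<partial>lebesgue)"
  proof (rule integral_mono)
    fix x
    have "g x / c - p x = (1 - c) / c * g x + (g x - p x)" using c by (simp add: field_simps)
    also have "\<bar>\<dots>\<bar> \<le> \<bar>(1 - c) / c * g x\<bar> + \<bar>g x - p x\<bar>" by (rule abs_triangle_ineq)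
    also have "\<bar>(1 - c) / c * g x\<bar> = \<bar>1 - c\<bar> / c * g x" using c gpos[of x] by (simp add: abs_mult)
    finally show "\<bar>g x / c - p x\<bar> \<le> \<bar>1 - c\<bar> / c * g x + \<bar>g x - p x\<bar>" .
  qed (use gi pi in auto)
  also have "\<dots> = \<bar>1 - c\<bar> + (\<integral>x. \<bar>g x - p x\<bar> \<partial>lebesgue)"
    using gi pi c by (simp add: c_def[symmetric])
  also have "\<dots> < e" using gp c1 unfolding d_def by linarith
  finally have "(\<integral>x. \<bar>g x / c - p x\<bar> \<partial>lebesgue) < e" .
  moreover have "has_bochner_integral lebesgue (\<lambda>x. g x / c) 1"
    using gi c by (simp add: has_bochner_integral_iff c_def)
  moreover have "continuous_on UNIV (\<lambda>x. g x / c)" using c by (intro continuous_intros gc) auto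
  moreover have "0 < g x / c" for x using gpos c by simp
  ultimately show ?thesis using that by blast
qed

section \<open>Distribution functions and the transport map between two densities\<close>

text \<open>Continuity of \<open>g\<close> makes the distribution function differentiable
  everywhere, and positivity makes it strictly increasing, so its limits 0 and 1 are not attained.
  The range is thus the same for all such densities, which lets one distribution function be
  composed with the inverse of another.\<close>

lemma cdf_of_continuous_density:
  fixes g :: "real \<Rightarrow> real"
  assumes gc: "continuous_on UNIV g" and gpos: "\<And>x. 0 < g x" and gi: "has_bochner_integral lebesgue g 1"
  obtains G where "\<And>x. (G has_real_derivative g x) (at x)" "strict_mono G" "range G = {0<..<1}"
proof -
  \<comment> \<open>The theory of \<open>cdf\<close> concerns Borel measures; passing from
    \<open>lebesgue\<close> to \<open>lborel\<close> is harmless because \<open>g\<close> is Borel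
    measurable.\<close>
  define M where "M = density lborel (\<lambda>x. ennreal (g x))"
  have gm: "g \<in> borel_measurable borel" using gc by (rule borel_measurable_continuous_onI)
  have gi': "has_bochner_integral lborel g 1"
    using gi gm by (simp add: has_bochner_integral_iff integrable_completion integral_completion)
  have gi2: "integrable lborel g" using gi' by (simp add: has_bochner_integral_iff)
  have "emeasure M (space M) = 1"
    using gi' gm gpos
    by (simp add: M_def emeasure_density has_bochner_integral_iff nn_integral_eq_integral less_imp_le)
  then interpret prob_space M by (rule prob_spaceI)
  interpret real_distribution M
    by unfold_locales (auto simp: M_def)
  have diff: "cdf M y - cdf M x = integral {x..y} g" if "x < y" for x y
  proof -
    have "cdf M y - cdf M x = measure M {x<..y}" by (rule cdf_diff_eq[OF that])
    also have "\<dots> = (\<integral>z. g z * indicator {x<..y} z \<partial>lborel)"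
    proof -
      have "emeasure M {x<..y} = (\<integral>\<^sup>+z. ennreal (g z * indicator {x<..y} z) \<partial>lborel)"
        unfolding M_def using gm
        by (subst emeasure_density) (auto intro!: nn_integral_cong split: split_indicator)
      also have "\<dots> = ennreal (\<integral>z. g z * indicator {x<..y} z \<partial>lborel)"
        using gpos gi2 by (intro nn_integral_eq_integral)
          (auto intro!: integrable_real_mult_indicator simp: less_imp_le)
      finally show ?thesis
        using gpos by (simp add: measure_def less_imp_le)
    qed
    also have "\<dots> = set_lebesgue_integral lborel {x<..y} g"
      by (simp add: set_lebesgue_integral_def mult.commute)
    \<comment> \<open>A difference of \<open>cdf\<close> values is the mass of a half-open interval.
      Adding the null endpoint gives the closed interval used in the fundamental theorem of
      calculus.\<close>
    also have "\<dots> = set_lebesgue_integral lborel {x..y} g"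
      by (rule set_integral_cong_set)
         (use gm AE_lborel_singleton[of x] in \<open>auto simp: set_borel_measurable_def\<close>)
    also have "\<dots> = integral {x..y} g"
      by (intro set_borel_integral_eq_integral borel_integrable_atLeastAtMost')
         (use gc continuous_on_subset in blast)
    finally show ?thesis .
  qed
  have der: "(cdf M has_real_derivative g x) (at x)" for x
  proof -
    \<comment> \<open>The base point \<open>x - 1\<close> puts \<open>x\<close> in the interior of
      the interval, so the one-interval derivative becomes a full one.\<close>
    have "((\<lambda>u. integral {x - 1..u} g) has_real_derivative g x) (at x within {x - 1..x + 1})"
      by (rule integral_has_real_derivative) (use gc continuous_on_subset in \<open>auto\<close>)
    then have "((\<lambda>u. integral {x - 1..u} g) has_real_derivative g x) (at x)"
      by (subst (asm) at_within_interior) (auto simp: interior_atLeastAtMost_real)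
    then have "((\<lambda>u. cdf M (x - 1) + integral {x - 1..u} g) has_real_derivative g x) (at x)"
      by (auto intro!: derivative_eq_intros)
    then show ?thesis
    proof (rule has_field_derivative_transform_within_open[where S = "{x - 1<..}"])
      fix u assume "u \<in> {x - 1<..}"
      then show "cdf M (x - 1) + integral {x - 1..u} g = cdf M u" using diff[of "x - 1" u] by simp
    qed auto
  qed
  have mono: "strict_mono (cdf M)"
    by (rule strict_monoI, rule DERIV_pos_imp_increasing) (use der gpos in blast)+
  have "range (cdf M) = {0<..<1}"
  proof (intro subset_antisym subsetI)
    fix y assume "y \<in> range (cdf M)"
    then obtain x where x: "y = cdf M x" by auto
    have "0 < y" using cdf_nonneg[of "x - 1"] strict_monoD[OF mono, of "x - 1" x] x by simp
    moreover have "y < 1" using cdf_bounded_prob[of "x + 1"] strict_monoD[OF mono, of x "x + 1"] x by simp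
    ultimately show "y \<in> {0<..<1}" by simp
  next
    fix y :: real assume y: "y \<in> {0<..<1}"
    have "\<forall>\<^sub>F x in at_bot. cdf M x < y" "\<forall>\<^sub>F x in at_top. y < cdf M x"
      using y order_tendstoD[OF cdf_lim_at_bot] order_tendstoD[OF cdf_lim_at_top_prob] by auto
    then obtain a b where a: "\<And>x. x \<le> a \<Longrightarrow> cdf M x < y" and b: "\<And>x. x \<ge> b \<Longrightarrow> y < cdf M x"
      by (auto simp: eventually_at_bot_linorder eventually_at_top_linorder)
    \<comment> \<open>\<open>min\<close> and \<open>max\<close> spare a proof that \<open>a\<close>
      lies to the left of \<open>b\<close>.\<close>
    have "\<exists>x\<ge>min a b. x \<le> max a b \<and> cdf M x = y"
    proof (rule IVT')
      show "continuous_on {min a b..max a b} (cdf M)"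
        using DERIV_isCont[OF der] by (simp add: continuous_at_imp_continuous_on)
    qed (use a[of "min a b"] b[of "max a b"] in auto)
    then show "y \<in> range (cdf M)" by auto
  qed
  then show ?thesis using that der mono by blast
qed


text \<open>The map is \<open>inv B\<close> after \<open>A\<close>, which matches quantiles.
  Differentiating \<open>B (f z) = A z\<close> gives its derivative, and exchanging the two
  densities gives the inverse map.\<close>

lemma continuous_density_transport:
  fixes a b :: "real \<Rightarrow> real"
  assumes a: "continuous_on UNIV a" "\<And>x. 0 < a x" "has_bochner_integral lebesgue a 1"
    and b: "continuous_on UNIV b" "\<And>x. 0 < b x" "has_bochner_integral lebesgue b 1"
  obtains f k where "\<And>y. f (k y) = y" "\<And>z. k (f z) = z"
    "\<And>z. (f has_real_derivative a z / b (f z)) (at z)"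
    "\<And>y. (k has_real_derivative b y / a (k y)) (at y)"
proof -
  obtain A where A: "\<And>x. (A has_real_derivative a x) (at x)" "strict_mono A" "range A = {0<..<1}"
    using cdf_of_continuous_density[OF a] by blast
  obtain B where B: "\<And>x. (B has_real_derivative b x) (at x)" "strict_mono B" "range B = {0<..<1}"
    using cdf_of_continuous_density[OF b] by blast
  have inv: "inv H (H x) = x" if "strict_mono H" for H :: "real \<Rightarrow> real" and x
    using that by (simp add: strict_mono_imp_inj_on)
  \<comment> \<open>Stated for a general pair \<open>H\<close>, \<open>L\<close> so that it serves
    both directions of the transport.\<close>
  have der: "((\<lambda>z. inv H (L z)) has_real_derivative l z / h (inv H (L z))) (at z)"
    if H: "\<And>x. (H has_real_derivative h x) (at x)" "strict_mono H" "range H = {0<..<1}" "\<And>x. 0 < h x"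
      and L: "\<And>x. (L has_real_derivative l x) (at x)" "range L = {0<..<1}"
    for H L h l :: "real \<Rightarrow> real" and z
  proof -
    define y where "y = inv H (L z)"
    \<comment> \<open>\<open>inv H\<close> is a genuine inverse only on the range of
      \<open>H\<close>; the common range {0<..<1} ensures that \<open>L z\<close> lies
      there.\<close>
    have "L z \<in> range H" using H(3) L(2) by auto
    then have y: "H y = L z" by (simp add: y_def f_inv_into_f)
    have "(inv H has_real_derivative inverse (h y)) (at (H y))"
      unfolding has_field_derivative_def
    proof (rule has_derivative_inverse_strong[where S = UNIV and f = H and x = y and f' = "(*) (h y)"])
      show "continuous_on UNIV H"
        using DERIV_isCont[OF H(1)] by (simp add: continuous_at_imp_continuous_on)
      show "(H has_derivative (*) (h y)) (at y)" using H(1) by (simp add: has_field_derivative_def)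
      show "(*) (h y) \<circ> (*) (inverse (h y)) = id" using H(4)[of y] by (auto simp: fun_eq_iff)
    qed (use inv[OF H(2)] in auto)
    then have "(inv H has_real_derivative inverse (h y)) (at (L z))" by (simp add: y)
    from DERIV_chain2[OF this L(1)] show ?thesis by (simp add: y_def field_simps)
  qed
  have "inv B (A (inv A (B y))) = y" for y
  proof -
    have "B y \<in> range A" using A(3) B(3) by auto
    then show ?thesis by (simp add: f_inv_into_f inv[OF B(2)])
  qed
  moreover have "inv A (B (inv B (A z))) = z" for z
  proof -
    have "A z \<in> range B" using A(3) B(3) by auto
    then show ?thesis by (simp add: f_inv_into_f inv[OF A(2)])
  qed
  ultimately show ?thesis
    using that[of "\<lambda>z. inv B (A z)" "\<lambda>y. inv A (B y)"]
      der[OF B b(2) A(1,3)] der[OF A a(2) B(1,3)] by blast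
qed

section \<open>Change of variables and the push-forward density\<close>

lemma lebesgue_integral_substitution_real:
  fixes k k' u :: "real \<Rightarrow> real"
  assumes k: "\<And>y. (k has_real_derivative k' y) (at y)" "bij k" and pos: "\<And>y. 0 \<le> k' y"
    and u: "integrable lebesgue u"
  shows "has_bochner_integral lebesgue (\<lambda>y. k' y * u (k y)) (integral\<^sup>L lebesgue u)"
proof -
  \<comment> \<open>\<open>eq\<close> and \<open>int\<close> translate between the Bochner integral
    and the gauge integral with absolute integrability, in which the change of variables theorem is
    phrased.\<close>
  have eq: "integral\<^sup>L lebesgue v = integral UNIV v" if "integrable lebesgue v" for v :: "real \<Rightarrow> real"
    using lebesgue_integral_eq_integral[of UNIV v] that by (simp add: lebesgue_on_UNIV_eq)
  have int: "v absolutely_integrable_on UNIV \<longleftrightarrow> integrable lebesgue v" for v :: "real \<Rightarrow> real"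
    by (simp add: set_integrable_def)
  have "range k = UNIV" "inj k" using k(2) by (auto simp: bij_def)
  then have "integrable lebesgue (\<lambda>y. k' y * u (k y)) \<and>
      integral UNIV (\<lambda>y. k' y * u (k y)) = integral UNIV u"
    using has_absolute_integral_change_of_variables_1'[of UNIV k k' u "integral UNIV u"] k(1) u pos
    by (simp add: int)
  then show ?thesis using u by (simp add: eq has_bochner_integral_iff)
qed

lemma pushforward_density_diffeomorphism:
  fixes f k k' q :: "real \<Rightarrow> real"
  assumes fk: "\<And>y. f (k y) = y" and kf: "\<And>z. k (f z) = z"
    and k: "\<And>y. (k has_real_derivative k' y) (at y)" and pos: "\<And>y. 0 \<le> k' y"
    and qi: "integrable lebesgue q" and q0: "\<And>z. 0 \<le> q z"
  shows "pushforward_density f q (\<lambda>y. k' y * q (k y))"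
proof -
  let ?M = "density lebesgue (\<lambda>z. ennreal (q z))"
  have bij: "bij k" by (rule o_bij[of f k]) (simp_all add: fun_eq_iff fk kf)
  have pre: "f -` S = k ` S" for S
  proof (intro subset_antisym subsetI)
    fix z assume "z \<in> f -` S"
    then show "z \<in> k ` S" using kf[of z] by (intro image_eqI[of _ _ "f z"]) auto
  qed (auto simp: fk)
  \<comment> \<open>Continuity of \<open>f\<close> would give only Borel measurability. For Lebesgue
    sets the differentiability of \<open>k\<close> is used: differentiable images of Lebesgue sets
    in the same dimension are Lebesgue measurable.\<close>
  have kS: "k ` S \<in> sets lebesgue" if "S \<in> sets lebesgue" for S
  proof (rule differentiable_image_in_sets_lebesgue[OF that])
    have "k differentiable (at y within S)" for y
      using has_field_derivative_imp_has_derivative[OF k] by (metis differentiable_at_withinI differentiable_def)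
    then show "k differentiable_on S" by (simp add: differentiable_on_def)
  qed simp
  have fm: "f \<in> measurable ?M lebesgue"
    by (rule measurableI) (auto simp: pre kS)
  have rm: "integrable lebesgue (\<lambda>y. k' y * q (k y))"
    using lebesgue_integral_substitution_real[OF k bij pos qi] by (simp add: has_bochner_integral_iff)
  have "distr ?M lebesgue f = density lebesgue (\<lambda>y. ennreal (k' y * q (k y)))"
  proof (rule measure_eqI)
    fix S assume "S \<in> sets (distr ?M lebesgue f)"
    then have S: "S \<in> sets lebesgue" by simp
    let ?u = "\<lambda>z. q z * indicator (k ` S) z"
    have ui: "integrable lebesgue ?u" using qi kS[OF S] by (rule integrable_real_mult_indicator[rotated])
    have ind: "indicator (k ` S) (k y) = (indicator S y :: real)" for y
      using bij by (auto simp: indicator_def bij_def inj_image_mem_iff)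
    note sub = lebesgue_integral_substitution_real[OF k bij pos ui, unfolded has_bochner_integral_iff ind]
    have "emeasure (distr ?M lebesgue f) S = (\<integral>\<^sup>+z. ennreal (?u z) \<partial>lebesgue)"
      using S fm kS[OF S] qi
      by (simp add: emeasure_distr pre emeasure_density)
        (auto intro!: nn_integral_cong split: split_indicator)
    also have "\<dots> = ennreal (integral\<^sup>L lebesgue ?u)"
      using ui q0 by (intro nn_integral_eq_integral) auto
    also have "\<dots> = ennreal (\<integral>y. k' y * (q (k y) * indicator S y) \<partial>lebesgue)"
      using sub by simp
    also have "\<dots> = (\<integral>\<^sup>+y. ennreal (k' y * (q (k y) * indicator S y)) \<partial>lebesgue)"
      using sub q0 pos by (intro nn_integral_eq_integral[symmetric]) auto
    also have "\<dots> = emeasure (density lebesgue (\<lambda>y. ennreal (k' y * q (k y)))) S"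
      using S rm by (subst emeasure_density)
        (auto intro!: nn_integral_cong split: split_indicator)
    finally show "emeasure (distr ?M lebesgue f) S = \<dots>" .
  qed simp
  then show ?thesis
    using fm rm q0 pos unfolding pushforward_density_def distributed_def
    by (auto intro!: measurable_compose[OF _ measurable_ennreal] borel_measurable_integrable)
qed

section \<open>The planar flow and its L^1 error\<close>

theorem theorem3p1:
  fixes p q :: "real \<Rightarrow> real" and \<epsilon> :: real
  assumes "prob_density p" and "prob_density q"
    and "finite_union_of_intervals {x. p x > 0}"
    and "{x. q x > 0} = UNIV"
    and "\<epsilon> > 0"
  shows "\<exists>f r. planar_flow f \<and> pushforward_density f q r \<and> L1_norm (\<lambda>x. r x - p x) \<le> ennreal \<epsilon>"
proof -
  have e: "\<epsilon> / 2 > 0" using assms(5) by simp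
  obtain a where a: "continuous_on UNIV a" "\<And>x. 0 < a x" "has_bochner_integral lebesgue a 1"
    and aq: "(\<integral>x. \<bar>a x - q x\<bar> \<partial>lebesgue) < \<epsilon> / 2"
    using continuous_density_approx[OF assms(2) e] by blast
  obtain b where b: "continuous_on UNIV b" "\<And>x. 0 < b x" "has_bochner_integral lebesgue b 1"
    and bp: "(\<integral>x. \<bar>b x - p x\<bar> \<partial>lebesgue) < \<epsilon> / 2"
    using continuous_density_approx[OF assms(1) e] by blast
  obtain f k where fk: "\<And>y. f (k y) = y" and kf: "\<And>z. k (f z) = z"
    and f': "\<And>z. (f has_real_derivative a z / b (f z)) (at z)"
    and k': "\<And>y. (k has_real_derivative b y / a (k y)) (at y)"
    using continuous_density_transport[OF a b] by blast
  \<comment> \<open>The factor in front of \<open>q (k y)\<close> is the derivative of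
    \<open>k\<close>. Replacing \<open>q\<close> by \<open>a\<close> would turn \<open>r\<close>
    into \<open>b\<close>.\<close>
  define r where "r y = b y / a (k y) * q (k y)" for y
  have qi: "integrable lebesgue q" and pi: "integrable lebesgue p"
    and ai: "integrable lebesgue a" and bi: "integrable lebesgue b" and q0: "0 \<le> q z" for z
    using assms(1,2) a b by (auto simp: prob_density_def has_bochner_integral_iff)
  have pos: "0 \<le> b y / a (k y)" for y using a(2)[of "k y"] b(2)[of y] by simp
  have bij: "bij f" "bij k" by (rule o_bij[of k f] o_bij[of f k]; simp add: fun_eq_iff fk kf)+
  have push: "pushforward_density f q r"
    unfolding r_def using fk kf k' pos qi q0 by (rule pushforward_density_diffeomorphism)
  have "deriv f z \<noteq> 0" for z
    using DERIV_imp_deriv[OF f', of z] a(2)[of z] b(2)[of "f z"] by simp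
  moreover have "f differentiable at z" for z
    using f' by (metis field_differentiable_def field_differentiable_imp_differentiable)
  ultimately have "normalizing_flow f" using bij by (simp add: normalizing_flow_def)
  then have planar: "planar_flow f"
    unfolding planar_flow_def
    by (intro conjI, assumption, rule_tac x = 1 in exI, rule_tac x = 1 in exI, rule_tac x = 0 in exI)
      (rule exI[of _ "\<lambda>z. f z - z"], simp)
  have ri: "integrable lebesgue r"
    using lebesgue_integral_substitution_real[OF k' bij(2) pos qi]
    by (simp add: r_def[abs_def] has_bochner_integral_iff)
  \<comment> \<open>As \<open>r\<close> and \<open>b\<close> are the push-forwards of
    \<open>q\<close> and \<open>a\<close> under the same map, their difference carries the Jacobian
    factor of \<open>k\<close>. Substitution then shows that the L^1 distance is preserved.\<close>
  have "\<bar>r y - b y\<bar> = b y / a (k y) * \<bar>a (k y) - q (k y)\<bar>" for y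
  proof -
    have "r y - b y = b y / a (k y) * (q (k y) - a (k y))"
      using a(2)[of "k y"] by (simp add: r_def field_simps)
    then show ?thesis using pos[of y] by (metis abs_mult abs_minus_commute abs_of_nonneg)
  qed
  then have rb: "(\<integral>y. \<bar>r y - b y\<bar> \<partial>lebesgue) = (\<integral>z. \<bar>a z - q z\<bar> \<partial>lebesgue)"
    using lebesgue_integral_substitution_real[OF k' bij(2) pos, of "\<lambda>z. \<bar>a z - q z\<bar>"] ai qi
    by (simp add: has_bochner_integral_iff)
  have "(\<integral>y. \<bar>r y - p y\<bar> \<partial>lebesgue) \<le> (\<integral>y. \<bar>r y - b y\<bar> + \<bar>b y - p y\<bar> \<partial>lebesgue)"
    by (rule integral_mono) (use ri bi pi in auto)
  also have "\<dots> \<le> \<epsilon>" using ri bi pi rb aq bp by simp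
  finally have "L1_norm (\<lambda>x. r x - p x) \<le> ennreal \<epsilon>"
    using ri pi unfolding L1_norm_def by (subst nn_integral_eq_integral) (auto intro: ennreal_leI)
  then show ?thesis using planar push by blast
qed

end
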